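(* Let $n_1,\dots,n_t$ be positive integers, $v=n_1\cdots n_t$, and identify the finite abelian group $\mathrm{G}$ with $\prod_{l=1}^t\mathbb{Z}/n_l\mathbb{Z}$, with identity $e$. Let $k>1$ and $\lambda_1,\lambda_2\ge 0$ be integers and let $\mathrm{M}\subset\mathrm{G}$ be nonempty. Let $S=\{(i_1,\dots,i_t)\in\mathbb{Z}^t:0\le i_l\le n_l-1\text{ for all }l\}$, $U=\{(\xi_1,\dots,\xi_t)\in\mathbb{C}^t:\xi_l^{n_l}=1\text{ for all }l\}$, and $\mathrm{M}^*=\{(i_1,\dots,i_t)\in S:(i_1+n_1\mathbb{Z},\dots,i_t+n_t\mathbb{Z})\in\mathrm{M}\}$. Let $A=(A_{i_1\cdots i_t}:(i_1,\dots,i_t)\in S)$ be independent indeterminates and define $$\Psi^*(X,A)=\Big(\sum_{S}A_{i_1\cdots i_t}X_1^{i_1}\cdots X_t^{i_t}\Big)\Big(\sum_{S}A_{i_1\cdots i_t}X_1^{n_1-i_1}\cdots X_t^{n_t-i_t}\Big)-\lambda_1\sum_{\mathrm{M}^*}X_1^{i_1}\cdots X_t^{i_t}-\lambda_2\sum_{S\setminus\mathrm{M}^*}X_1^{i_1}\cdots X_t^{i_t}-c,$$ where $c=k-\lambda_1$ if $e\in\mathrm{M}$ and $c=k-\lambda_2$ if $e\notin\mathrm{M}$. For $(i_1,\dots,i_t)\in S$ let $P_{i_1\cdots i_t}(A)=A_{i_1\cdots i_t}^2-A_{i_1\cdots i_t}$. Then $\alpha=(\alpha_{i_1\cdots i_t}:(i_1,\dots,i_t)\in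 S)\in\mathbb{C}^{n_1\cdots n_t}$ is the point representation of a $(v,|\mathrm{M}|,k,\lambda_1,\lambda_2)$ generalized difference set in $\mathrm{G}$ related to $\mathrm{M}$ if and only if $P_{i_1\cdots i_t}(\alpha)=0$ for all $(i_1,\dots,i_t)\in S$ and $\Psi^*(\xi,\alpha)=0$ for all $\xi\in U$.
   Context: The point representation of a subset $\mathrm{T}\subset\mathrm{G}$ is the vector $\alpha\in\mathbb{C}^{n_1\cdots n_t}$ indexed by $S$ with $\alpha_{i_1\cdots i_t}=1$ if $(i_1+n_1\mathbb{Z},\dots,i_t+n_t\mathbb{Z})\in\mathrm{T}$ and $0$ otherwise. For a finite group $\mathrm{G}$ of order $v$ with identity $e$, subsets $\mathrm{D},\mathrm{M}\subset\mathrm{G}$ with $|\mathrm{D}|=k>1$, $|\mathrm{M}|>0$, and nonnegative integers $\lambda_1,\lambda_2$, let $\lambda_g=|\{(d_1,d_2)\in\mathrm{D}\times\mathrm{D}:g=d_1d_2^{-1}\}|$; $\mathrm{D}$ is a $(v,|\mathrm{M}|,k,\lambda_1,\lambda_2)$ generalized difference set related to $\mathrm{M}$ if for every $g\ne e$, $\lambda_g=\lambda_1$ when $g\in\mathrm{M}$ and $\lambda_g=\lambda_2$ when $g\notin\mathrm{M}$. *)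

theory Defs
  imports Complex_Main "HOL-Algebra.Product_Groups"
begin

definition diff_count :: "('a, 'b) monoid_scheme \<Rightarrow> 'a set \<Rightarrow> 'a \<Rightarrow> nat"
  where "diff_count G D g =
    card {(d1, d2). d1 \<in> D \<and> d2 \<in> D \<and> g = d1 \<otimes>\<^bsub>G\<^esub> inv\<^bsub>G\<^esub> d2}"

definition generalized_difference_set ::
    "('a, 'b) monoid_scheme \<Rightarrow> 'a set \<Rightarrow> nat \<Rightarrow> nat \<Rightarrow> nat \<Rightarrow> nat \<Rightarrow> nat \<Rightarrow> 'a set \<Rightarrow> bool"
  where "generalized_difference_set G M v m k lam1 lam2 D \<longleftrightarrow>
    group G \<and> finite (carrier G) \<and> order G = v \<and>
    D \<subseteq> carrier G \<and> card D = k \<and> k > 1 \<and>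
    M \<subseteq> carrier G \<and> card M = m \<and> m > 0 \<and>
    (\<forall>g \<in> carrier G. g \<noteq> \<one>\<^bsub>G\<^esub> \<longrightarrow>
       (g \<in> M \<longrightarrow> diff_count G D g = lam1) \<and>
       (g \<notin> M \<longrightarrow> diff_count G D g = lam2))"

text \<open>A \<open>t\<close>-tuple is a function on \<open>{1..t}\<close>, \<open>undefined\<close> elsewhere. The library's
  \<^const>\<open>integer_mod_group\<close> represents a residue class by its least nonnegative member,
  so the class of \<open>a\<close> modulo \<open>n l\<close> is \<open>a mod n l\<close>.\<close>

definition cyclic_product :: "nat \<Rightarrow> (nat \<Rightarrow> nat) \<Rightarrow> (nat \<Rightarrow> int) monoid"
  where "cyclic_product t n = product_group {1..t} (\<lambda>l. integer_mod_group (n l))"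

definition residue_tuple :: "nat \<Rightarrow> (nat \<Rightarrow> nat) \<Rightarrow> (nat \<Rightarrow> int) \<Rightarrow> (nat \<Rightarrow> int)"
  where "residue_tuple t n i = (\<lambda>l\<in>{1..t}. i l mod int (n l))"

definition index_box :: "nat \<Rightarrow> (nat \<Rightarrow> nat) \<Rightarrow> (nat \<Rightarrow> int) set"
  where "index_box t n = (\<Pi>\<^sub>E l\<in>{1..t}. {0..int (n l) - 1})"

definition index_preimage :: "nat \<Rightarrow> (nat \<Rightarrow> nat) \<Rightarrow> (nat \<Rightarrow> int) set \<Rightarrow> (nat \<Rightarrow> int) set"
  where "index_preimage t n M = {i \<in> index_box t n. residue_tuple t n i \<in> M}"

definition unity_tuples :: "nat \<Rightarrow> (nat \<Rightarrow> nat) \<Rightarrow> (nat \<Rightarrow> complex) set"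
  where "unity_tuples t n = {\<xi> \<in> {1..t} \<rightarrow>\<^sub>E UNIV. \<forall>l\<in>{1..t}. \<xi> l ^ n l = 1}"

definition point_representation ::
    "nat \<Rightarrow> (nat \<Rightarrow> nat) \<Rightarrow> (nat \<Rightarrow> int) set \<Rightarrow> ((nat \<Rightarrow> int) \<Rightarrow> complex)"
  where "point_representation t n T =
    (\<lambda>i\<in>index_box t n. if residue_tuple t n i \<in> T then 1 else 0)"

definition monom_at :: "nat \<Rightarrow> (nat \<Rightarrow> 'a::comm_ring_1) \<Rightarrow> (nat \<Rightarrow> int) \<Rightarrow> 'a"
  where "monom_at t X i = (\<Prod>l\<in>{1..t}. X l ^ nat (i l))"

text \<open>The polynomials \<open>\<Psi>\<^sup>*(X, A)\<close> and \<open>P\<^sub>i(A)\<close> have integer coefficients; they are given by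
  their values in an arbitrary commutative ring, for any assignment to the \<open>X\<^sub>l\<close> and \<open>A\<^sub>i\<close>.\<close>

definition Psi_star ::
    "nat \<Rightarrow> (nat \<Rightarrow> nat) \<Rightarrow> (nat \<Rightarrow> int) set \<Rightarrow> nat \<Rightarrow> nat \<Rightarrow> nat \<Rightarrow>
     (nat \<Rightarrow> 'a::comm_ring_1) \<Rightarrow> ((nat \<Rightarrow> int) \<Rightarrow> 'a) \<Rightarrow> 'a"
  where "Psi_star t n M k lam1 lam2 X A =
    (\<Sum>i\<in>index_box t n. A i * monom_at t X i) *
    (\<Sum>i\<in>index_box t n. A i * monom_at t X (\<lambda>l. int (n l) - i l))
    - of_nat lam1 * (\<Sum>i\<in>index_preimage t n M. monom_at t X i)
    - of_nat lam2 * (\<Sum>i\<in>index_box t n - index_preimage t n M. monom_at t X i)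
    - (if \<one>\<^bsub>cyclic_product t n\<^esub> \<in> M then of_nat k - of_nat lam1 else of_nat k - of_nat lam2)"

definition P_poly :: "(nat \<Rightarrow> int) \<Rightarrow> ((nat \<Rightarrow> int) \<Rightarrow> 'a::comm_ring_1) \<Rightarrow> 'a"
  where "P_poly i A = (A i)\<^sup>2 - A i"

end

theory Submission
  imports Defs
begin

text \<open>
  Expanding the product at a tuple of roots of unity gives the character sum
  \<open>\<Psi>\<^sup>*(\<xi>, \<alpha>) = \<Sum>\<^sub>g (\<lambda>\<^sub>g - \<mu>\<^sub>g) \<xi>\<^sup>g\<close>, where \<open>\<mu>\<^sub>g\<close> is the value prescribed for \<open>\<lambda>\<^sub>g\<close>
  (and \<open>k\<close> at the identity). By orthogonality of characters it vanishes for all \<open>\<xi>\<close> iff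
  \<open>\<lambda>\<^sub>g = \<mu>\<^sub>g\<close> for all \<open>g\<close>; the identity coefficient says that the set has \<open>k\<close> elements.
\<close>

section \<open>Orthogonality of characters at tuples of roots of unity\<close>

text \<open>If \<open>n\<close> does not divide \<open>m\<close>, some root \<open>w\<close> has
  \<open>w ^ m\<close> different from 1. Multiplication by \<open>w\<close> permutes the roots, so
  the sum equals \<open>w ^ m\<close> times itself and must vanish.\<close>

lemma sum_roots_unity_power:
  assumes "n > 0"
  shows "(\<Sum>z | z ^ n = 1. z ^ m :: complex) = (if n dvd m then of_nat n else 0)"
proof (cases "n dvd m")
  case True
  then have "z ^ m = 1" if "z ^ n = 1" for z :: complex
    using that by (elim dvdE) (simp add: power_mult)
  then have "(\<Sum>z | z ^ n = 1. z ^ m :: complex) = (\<Sum>z::complex | z ^ n = 1. 1)"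
    by (intro sum.cong) auto
  with True show ?thesis
    using card_roots_unity_eq[OF assms] by simp
next
  case False
  define r where "r = m mod n"
  have r: "0 < r" "r < n"
    using False assms by (auto simp: r_def dvd_eq_mod_eq_0)
  have red: "z ^ m = z ^ r" if "z ^ n = 1" for z :: complex
  proof -
    have "z ^ m = z ^ (n * (m div n) + m mod n)"
      by simp
    also have "\<dots> = z ^ r"
      using that by (simp only: power_add power_mult) (simp add: r_def)
    finally show ?thesis .
  qed
  \<comment> \<open>Counting replaces an explicit primitive root: otherwise all \<open>n\<close>
    roots of \<open>z ^ n = 1\<close> would satisfy \<open>z ^ r = 1\<close>, which has at most
    \<open>r < n\<close> solutions.\<close>
  have "\<exists>w::complex. w ^ n = 1 \<and> w ^ r \<noteq> 1"
  proof (rule ccontr)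
    assume "\<not> ?thesis"
    then have "{z::complex. z ^ n = 1} \<subseteq> {z. z ^ r = 1}"
      by auto
    then have "card {z::complex. z ^ n = 1} \<le> card {z::complex. z ^ r = 1}"
      using r by (intro card_mono finite_roots_unity) auto
    also have "\<dots> \<le> r"
      using r by (intro card_roots_unity) auto
    finally show False
      using card_roots_unity_eq[OF assms] r by simp
  qed
  then obtain w :: complex where w: "w ^ n = 1" "w ^ m \<noteq> 1"
    using red by metis
  have w0: "w \<noteq> 0"
    using w assms by (auto simp: power_0_left)
  have bij: "bij_betw (\<lambda>z. w * z) {z. z ^ n = 1} {z. z ^ n = 1}"
    by (rule bij_betw_byWitness[where f' = "\<lambda>z. z / w"])
       (use w w0 in \<open>auto simp: power_mult_distrib power_divide\<close>)
  have "(\<Sum>z | z ^ n = 1. z ^ m) = (\<Sum>z | z ^ n = 1. (w * z) ^ m)"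
    by (rule sum.reindex_bij_betw[OF bij, symmetric])
  also have "\<dots> = w ^ m * (\<Sum>z | z ^ n = 1. z ^ m)"
    by (simp add: power_mult_distrib sum_distrib_left)
  finally show ?thesis
    using w(2) False by auto
qed

lemma finite_index_box: "finite (index_box t n)"
  by (auto simp: index_box_def intro!: finite_PiE)

lemma unity_tuples_eq_PiE: "unity_tuples t n = (\<Pi>\<^sub>E l\<in>{1..t}. {z. z ^ n l = 1})"
  unfolding unity_tuples_def PiE_def Pi_def by blast

text \<open>At roots of unity the monomial with exponents \<open>n l - j l\<close> is the inverse of
  the one with exponents \<open>j l\<close>. The sum factors over the coordinates, and each factor
  is a power sum of roots of unity.\<close>

lemma monom_at_reflect_product_orthogonality:
  assumes n: "\<forall>l\<in>{1..t}. n l > 0" and i: "i \<in> index_box t n" and j: "j \<in> index_box t n"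
  shows "(\<Sum>\<xi>\<in>unity_tuples t n. monom_at t \<xi> i * monom_at t \<xi> (\<lambda>l. int (n l) - j l))
           = (if i = j then of_nat (\<Prod>l\<in>{1..t}. n l) else 0)"
proof -
  \<comment> \<open>The exponent is \<open>i l - j l + n l\<close>. Both entries are reduced modulo
    \<open>n l\<close>, so congruence means equality.\<close>
  have dvd: "n l dvd nat (i l) + nat (int (n l) - j l) \<longleftrightarrow> i l = j l" if l: "l \<in> {1..t}" for l
  proof -
    have b: "0 \<le> i l" "i l < int (n l)" "0 \<le> j l" "j l < int (n l)"
      using i j l by (force simp: index_box_def PiE_iff)+
    have "n l dvd nat (i l) + nat (int (n l) - j l)
            \<longleftrightarrow> int (n l) dvd int (nat (i l) + nat (int (n l) - j l))"
      by (simp only: int_dvd_int_iff)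
    also have "int (nat (i l) + nat (int (n l) - j l)) = (i l - j l) + int (n l)"
      using b by simp
    also have "int (n l) dvd (i l - j l) + int (n l) \<longleftrightarrow> i l mod int (n l) = j l mod int (n l)"
      by (simp add: mod_eq_dvd_iff)
    also have "\<dots> \<longleftrightarrow> i l = j l"
      using b by simp
    finally show ?thesis .
  qed
  have "(\<Sum>\<xi>\<in>unity_tuples t n. monom_at t \<xi> i * monom_at t \<xi> (\<lambda>l. int (n l) - j l))
      = (\<Sum>\<xi>\<in>unity_tuples t n. \<Prod>l\<in>{1..t}. \<xi> l ^ (nat (i l) + nat (int (n l) - j l)))"
    by (simp add: monom_at_def prod.distrib power_add)
  also have "\<dots> = (\<Prod>l\<in>{1..t}. \<Sum>z | z ^ n l = 1. z ^ (nat (i l) + nat (int (n l) - j l)))"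
    unfolding unity_tuples_eq_PiE
    using n by (intro prod_sum_PiE[symmetric] finite_roots_unity) (auto simp: Suc_le_eq)
  also have "\<dots> = (\<Prod>l\<in>{1..t}. if i l = j l then of_nat (n l) else 0)"
    using n by (intro prod.cong refl) (simp add: sum_roots_unity_power dvd)
  also have "\<dots> = (if i = j then of_nat (\<Prod>l\<in>{1..t}. n l) else 0)"
  proof (cases "i = j")
    case False
    \<comment> \<open>Members of the box agree outside \<open>{1..t}\<close>, so they differ at some
      coordinate inside it, and that factor is zero.\<close>
    with i j obtain l where "l \<in> {1..t}" "i l \<noteq> j l"
      unfolding index_box_def by (meson PiE_ext)
    with False show ?thesis
      by (auto intro!: prod_zero)
  qed simp
  finally show ?thesis .
qed

text \<open>Fourier inversion: multiplying by the reflected monomial of \<open>j\<close> and summing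
  over all \<open>\<xi>\<close> leaves \<open>f j\<close> times the product of the
  \<open>n l\<close>, which is nonzero.\<close>

lemma character_sum_eq_0_iff:
  fixes f :: "(nat \<Rightarrow> int) \<Rightarrow> complex"
  assumes n: "\<forall>l\<in>{1..t}. n l > 0"
  shows "(\<forall>\<xi>\<in>unity_tuples t n. (\<Sum>i\<in>index_box t n. f i * monom_at t \<xi> i) = 0)
           \<longleftrightarrow> (\<forall>i\<in>index_box t n. f i = 0)"
proof
  assume L: "\<forall>\<xi>\<in>unity_tuples t n. (\<Sum>i\<in>index_box t n. f i * monom_at t \<xi> i) = 0"
  show "\<forall>i\<in>index_box t n. f i = 0"
  proof
    fix j assume j: "j \<in> index_box t n"
    let ?m = "\<lambda>\<xi>. monom_at t \<xi> (\<lambda>l. int (n l) - j l)"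
    have "0 = (\<Sum>\<xi>\<in>unity_tuples t n. (\<Sum>i\<in>index_box t n. f i * monom_at t \<xi> i) * ?m \<xi>)"
      using L by simp
    also have "\<dots> = (\<Sum>i\<in>index_box t n. f i * (\<Sum>\<xi>\<in>unity_tuples t n. monom_at t \<xi> i * ?m \<xi>))"
      by (simp add: sum_distrib_right sum_distrib_left mult.assoc) (rule sum.swap)
    also have "\<dots> = (\<Sum>i\<in>index_box t n. if i = j then f j * of_nat (\<Prod>l\<in>{1..t}. n l) else 0)"
      by (intro sum.cong refl)
         (simp add: monom_at_reflect_product_orthogonality[OF n _ j])
    also have "\<dots> = f j * of_nat (\<Prod>l\<in>{1..t}. n l)"
      using j by (simp add: finite_index_box)
    finally have "f j * of_nat (\<Prod>l\<in>{1..t}. n l) = 0" ..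
    moreover have "(\<Prod>l\<in>{1..t}. n l) > 0"
      using n by (intro prod_pos) auto
    ultimately show "f j = 0"
      by (metis less_not_refl mult_eq_0_iff of_nat_eq_0_iff)
  qed
qed simp

section \<open>The product of cyclic groups on the index box\<close>

lemma group_cyclic_product: "group (cyclic_product t n)"
  by (simp add: cyclic_product_def)

text \<open>Positivity of the moduli matters: \<open>integer_mod_group 0\<close> is the infinite
  group of all integers.\<close>

lemma carrier_cyclic_product:
  assumes "\<forall>l\<in>{1..t}. n l > 0"
  shows "carrier (cyclic_product t n) = index_box t n"
  unfolding cyclic_product_def index_box_def carrier_product_group
  using assms by (intro PiE_cong) (auto simp: carrier_integer_mod_group)

lemma order_cyclic_product:
  assumes "\<forall>l\<in>{1..t}. n l > 0"
  shows "order (cyclic_product t n) = (\<Prod>l\<in>{1..t}. n l)"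
  unfolding order_def carrier_cyclic_product[OF assms] index_box_def
  by (simp add: card_PiE)

lemma residue_tuple_index_box:
  assumes "i \<in> index_box t n"
  shows "residue_tuple t n i = i"
proof (rule ext)
  fix l
  show "residue_tuple t n i l = i l"
    using assms by (cases "l \<in> {1..t}")
      (force simp: residue_tuple_def index_box_def PiE_iff extensional_def)+
qed

text \<open>Residue classes are represented by their least nonnegative members, so passing from
  \<open>M\<close> to its set of indices changes nothing.\<close>

lemma index_preimage_eq:
  assumes "M \<subseteq> index_box t n"
  shows "index_preimage t n M = M"
  using assms by (auto simp: index_preimage_def residue_tuple_index_box)

text \<open>Since each \<open>\<xi> l\<close> is an \<open>n l\<close>-th root of unity, exponents
  count only modulo \<open>n l\<close>. For \<open>j l = 0\<close> the reflected exponent is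
  \<open>n l\<close>, not 0, which gives the same value 1.\<close>

lemma monom_at_mult_inv:
  fixes \<xi> :: "nat \<Rightarrow> complex"
  assumes n: "\<forall>l\<in>{1..t}. n l > 0" and \<xi>: "\<xi> \<in> unity_tuples t n"
    and i: "i \<in> index_box t n" and j: "j \<in> index_box t n"
  shows "monom_at t \<xi> (i \<otimes>\<^bsub>cyclic_product t n\<^esub> inv\<^bsub>cyclic_product t n\<^esub> j)
           = monom_at t \<xi> i * monom_at t \<xi> (\<lambda>l. int (n l) - j l)"
proof -
  have jc: "j \<in> (\<Pi>\<^sub>E l\<in>{1..t}. carrier (integer_mod_group (n l)))"
    using j carrier_cyclic_product[OF n] by (simp add: cyclic_product_def)
  have eq: "(i \<otimes>\<^bsub>cyclic_product t n\<^esub> inv\<^bsub>cyclic_product t n\<^esub> j) l = (i l - j l) mod int (n l)"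
    if l: "l \<in> {1..t}" for l
  proof -
    have "j l \<in> carrier (integer_mod_group (n l))"
      using jc l by (rule PiE_mem)
    then show ?thesis
      using l by (simp add: cyclic_product_def inv_product_group[OF jc] mod_add_right_eq del: One_nat_def)
  qed
  have "\<xi> l ^ nat ((i l - j l) mod int (n l)) = \<xi> l ^ (nat (i l) + nat (int (n l) - j l))"
    if l: "l \<in> {1..t}" for l
  proof -
    have b: "0 \<le> i l" "i l < int (n l)" "0 \<le> j l" "j l < int (n l)"
      using i j l by (force simp: index_box_def PiE_iff)+
    have u: "\<xi> l ^ n l = 1"
      using \<xi> l by (simp add: unity_tuples_def)
    \<comment> \<open>A natural number congruent to \<open>i l - j l\<close> modulo
      \<open>n l\<close>.\<close>
    define m where "m = nat (i l) + nat (int (n l) - j l)"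
    have "int m = (i l - j l) + int (n l)"
      using b by (simp add: m_def)
    then have "(i l - j l) mod int (n l) = int m mod int (n l)"
      by simp
    then have "nat ((i l - j l) mod int (n l)) = m mod n l"
      by (simp add: nat_mod_distrib)
    moreover have "\<xi> l ^ m = \<xi> l ^ (n l * (m div n l) + m mod n l)"
      by simp
    then have "\<xi> l ^ m = \<xi> l ^ (m mod n l)"
      using u by (simp only: power_add power_mult) simp
    ultimately show ?thesis
      by (simp add: m_def)
  qed
  then have "monom_at t \<xi> (i \<otimes>\<^bsub>cyclic_product t n\<^esub> inv\<^bsub>cyclic_product t n\<^esub> j)
      = (\<Prod>l\<in>{1..t}. \<xi> l ^ (nat (i l) + nat (int (n l) - j l)))"
    unfolding monom_at_def by (intro prod.cong refl) (simp add: eq)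
  then show ?thesis
    by (simp add: monom_at_def power_add prod.distrib)
qed

section \<open>Counting differences in a finite group\<close>

text \<open>The pairs in \<open>D \<times> D\<close> are grouped by their quotient;
  \<open>diff_count G D g\<close> is the size of the fibre over \<open>g\<close>. It is applied with
  \<open>h\<close> a character.\<close>

lemma sum_diff_count:
  fixes h :: "'a \<Rightarrow> 'c::comm_semiring_1"
  assumes "group G" "finite (carrier G)" "D \<subseteq> carrier G"
  shows "(\<Sum>g\<in>carrier G. of_nat (diff_count G D g) * h g)
           = (\<Sum>d\<in>D. \<Sum>d'\<in>D. h (d \<otimes>\<^bsub>G\<^esub> inv\<^bsub>G\<^esub> d'))"
proof -
  interpret group G by fact
  let ?q = "\<lambda>p. fst p \<otimes>\<^bsub>G\<^esub> inv\<^bsub>G\<^esub> (snd p)"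
  have D: "finite D"
    using assms finite_subset by blast
  have "(\<Sum>g\<in>carrier G. of_nat (diff_count G D g) * h g)
      = (\<Sum>g\<in>carrier G. \<Sum>p | p \<in> D \<times> D \<and> ?q p = g. h (?q p))"
  proof (intro sum.cong refl)
    fix g
    have "{(d1, d2). d1 \<in> D \<and> d2 \<in> D \<and> g = d1 \<otimes>\<^bsub>G\<^esub> inv\<^bsub>G\<^esub> d2} = {p. p \<in> D \<times> D \<and> ?q p = g}"
      by auto
    then show "of_nat (diff_count G D g) * h g = (\<Sum>p | p \<in> D \<times> D \<and> ?q p = g. h (?q p))"
      by (simp add: diff_count_def)
  qed
  \<comment> \<open>All quotients lie in the carrier, so the fibres exhaust
    \<open>D \<times> D\<close>.\<close>
  also have "\<dots> = (\<Sum>p\<in>D \<times> D. h (?q p))"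
    using D assms by (intro sum.group) (auto simp: subset_iff)
  also have "\<dots> = (\<Sum>d\<in>D. \<Sum>d'\<in>D. h (d \<otimes>\<^bsub>G\<^esub> inv\<^bsub>G\<^esub> d'))"
    by (simp add: sum.cartesian_product split_beta)
  finally show ?thesis .
qed

text \<open>A quotient is trivial only for equal elements. The size of \<open>D\<close> thus becomes
  the coefficient at the identity.\<close>

lemma diff_count_one:
  assumes "group G" "D \<subseteq> carrier G"
  shows "diff_count G D \<one>\<^bsub>G\<^esub> = card D"
proof -
  interpret group G by fact
  have "\<one>\<^bsub>G\<^esub> = d1 \<otimes>\<^bsub>G\<^esub> inv\<^bsub>G\<^esub> d2 \<longleftrightarrow> d1 = d2" if "d1 \<in> D" "d2 \<in> D" for d1 d2
    using that assms(2) by (metis inv_equality inv_inv inv_closed r_inv subsetD)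
  then have "{(d1, d2). d1 \<in> D \<and> d2 \<in> D \<and> \<one>\<^bsub>G\<^esub> = d1 \<otimes>\<^bsub>G\<^esub> inv\<^bsub>G\<^esub> d2} = (\<lambda>d. (d, d)) ` D"
    by blast
  then show ?thesis
    by (simp add: diff_count_def card_image inj_on_def)
qed

text \<open>The value \<open>k\<close> at the identity, whether or not it lies in \<open>M\<close>,
  puts the size condition on the same footing as the conditions on differences.\<close>

definition prescribed_count ::
    "('a, 'b) monoid_scheme \<Rightarrow> 'a set \<Rightarrow> nat \<Rightarrow> nat \<Rightarrow> nat \<Rightarrow> 'a \<Rightarrow> nat"
  where "prescribed_count G M k lam1 lam2 g =
    (if g = \<one>\<^bsub>G\<^esub> then k else if g \<in> M then lam1 else lam2)"

lemma generalized_difference_set_iff_prescribed_count: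
  assumes "group G" "finite (carrier G)" "M \<subseteq> carrier G" "M \<noteq> {}" "k > 1" "D \<subseteq> carrier G"
  shows "generalized_difference_set G M (order G) (card M) k lam1 lam2 D
           \<longleftrightarrow> (\<forall>g\<in>carrier G. diff_count G D g = prescribed_count G M k lam1 lam2 g)"
proof -
  interpret group G by fact
  have "card M > 0"
    using assms by (meson card_gt_0_iff finite_subset)
  then show ?thesis
    using assms diff_count_one[OF assms(1,6)] one_closed
    by (auto simp: generalized_difference_set_def prescribed_count_def)
qed

section \<open>\<open>Psi_star\<close> as a character sum\<close>

text \<open>The product of the two sums contributes the coefficients \<open>diff_count\<close>; the
  subtracted terms contribute \<open>prescribed_count\<close>.\<close>

lemma Psi_star_point_representation:
  fixes \<xi> :: "nat \<Rightarrow> complex"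
  assumes n: "\<forall>l\<in>{1..t}. n l > 0" and \<xi>: "\<xi> \<in> unity_tuples t n"
    and D: "D \<subseteq> index_box t n" and M: "M \<subseteq> index_box t n"
  shows "Psi_star t n M k lam1 lam2 \<xi> (point_representation t n D)
    = (\<Sum>g\<in>index_box t n.
        (of_nat (diff_count (cyclic_product t n) D g)
          - of_nat (prescribed_count (cyclic_product t n) M k lam1 lam2 g)) * monom_at t \<xi> g)"
proof -
  let ?G = "cyclic_product t n" and ?B = "index_box t n"
  let ?\<alpha> = "point_representation t n D" and ?m = "monom_at t \<xi>"
  let ?c = "if \<one>\<^bsub>?G\<^esub> \<in> M then of_nat k - of_nat lam1 else of_nat k - of_nat lam2 :: complex"
  interpret G: group ?G
    by (rule group_cyclic_product)
  note carrier = carrier_cyclic_product[OF n]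
  have alpha: "(\<Sum>i\<in>?B. ?\<alpha> i * h i) = (\<Sum>i\<in>D. h i)" for h :: "(nat \<Rightarrow> int) \<Rightarrow> complex"
    by (rule sum.mono_neutral_cong_right)
       (use D in \<open>auto simp: finite_index_box point_representation_def residue_tuple_index_box\<close>)
  have "(\<Sum>i\<in>?B. ?\<alpha> i * ?m i) * (\<Sum>i\<in>?B. ?\<alpha> i * ?m (\<lambda>l. int (n l) - i l))
      = (\<Sum>i\<in>D. \<Sum>j\<in>D. ?m i * ?m (\<lambda>l. int (n l) - j l))"
    by (simp only: alpha sum_product)
  also have "\<dots> = (\<Sum>i\<in>D. \<Sum>j\<in>D. ?m (i \<otimes>\<^bsub>?G\<^esub> inv\<^bsub>?G\<^esub> j))"
    using D by (intro sum.cong refl) (auto simp: monom_at_mult_inv[OF n \<xi>] subset_iff)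
  also have "\<dots> = (\<Sum>g\<in>?B. of_nat (diff_count ?G D g) * ?m g)"
    using D sum_diff_count[OF G.is_group, of D ?m] by (simp add: carrier finite_index_box)
  finally have product: "(\<Sum>i\<in>?B. ?\<alpha> i * ?m i) * (\<Sum>i\<in>?B. ?\<alpha> i * ?m (\<lambda>l. int (n l) - i l))
      = (\<Sum>g\<in>?B. of_nat (diff_count ?G D g) * ?m g)" .
  have one: "\<one>\<^bsub>?G\<^esub> \<in> ?B" "?m \<one>\<^bsub>?G\<^esub> = 1"
    using G.one_closed carrier by (auto simp: monom_at_def cyclic_product_def)
  \<comment> \<open>The sums over \<open>M\<close> and its complement already give the identity the
    coefficient \<open>lam1\<close> or \<open>lam2\<close>; \<open>?c\<close> corrects it to
    \<open>k\<close>. As the trivial monomial is 1, this correction is a constant.\<close>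
  have "(\<Sum>g\<in>?B. of_nat (prescribed_count ?G M k lam1 lam2 g) * ?m g)
      = (\<Sum>g\<in>?B. (of_nat (if g \<in> M then lam1 else lam2) * ?m g
                       + (if g = \<one>\<^bsub>?G\<^esub> then ?c else 0)))"
    using one by (intro sum.cong refl) (auto simp: prescribed_count_def)
  also have "\<dots> = (\<Sum>g\<in>?B. of_nat (if g \<in> M then lam1 else lam2) * ?m g) + ?c"
    using one by (simp add: sum.distrib finite_index_box)
  also have "(\<Sum>g\<in>?B. of_nat (if g \<in> M then lam1 else lam2) * ?m g)
      = (\<Sum>g\<in>M. of_nat (if g \<in> M then lam1 else lam2) * ?m g)
        + (\<Sum>g\<in>?B - M. of_nat (if g \<in> M then lam1 else lam2) * ?m g)"
    by (subst sum.subset_diff[OF M finite_index_box]) (rule add.commute)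
  also have "\<dots> = of_nat lam1 * (\<Sum>g\<in>M. ?m g) + of_nat lam2 * (\<Sum>g\<in>?B - M. ?m g)"
    by (simp add: sum_distrib_left)
  finally have "(\<Sum>g\<in>?B. of_nat (prescribed_count ?G M k lam1 lam2 g) * ?m g)
      = of_nat lam1 * (\<Sum>g\<in>M. ?m g) + of_nat lam2 * (\<Sum>g\<in>?B - M. ?m g) + ?c" .
  then show ?thesis
    unfolding Psi_star_def product index_preimage_eq[OF M]
    by (simp add: left_diff_distrib sum_subtractf)
qed

text \<open>Both sides reduce to equality of \<open>diff_count\<close> and
  \<open>prescribed_count\<close> on the whole group, because natural numbers embed injectively in
  the complex numbers.\<close>

lemma generalized_difference_set_iff_Psi_star:
  assumes n: "\<forall>l\<in>{1..t}. n l > 0" and "k > 1"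
    and M: "M \<subseteq> carrier (cyclic_product t n)" "M \<noteq> {}"
    and D: "D \<subseteq> index_box t n"
  shows "generalized_difference_set (cyclic_product t n) M
           (\<Prod>l\<in>{1..t}. n l) (card M) k lam1 lam2 D
    \<longleftrightarrow> (\<forall>\<xi>\<in>unity_tuples t n.
          Psi_star t n M k lam1 lam2 \<xi> (point_representation t n D) = (0::complex))"
proof -
  note carrier = carrier_cyclic_product[OF n]
  have "(\<forall>\<xi>\<in>unity_tuples t n.
          Psi_star t n M k lam1 lam2 \<xi> (point_representation t n D) = (0::complex))
      \<longleftrightarrow> (\<forall>g\<in>index_box t n. diff_count (cyclic_product t n) D g
              = prescribed_count (cyclic_product t n) M k lam1 lam2 g)"
    using character_sum_eq_0_iff[OF n] M D
    by (simp add: Psi_star_point_representation[OF n] carrier)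
  also have "\<dots> \<longleftrightarrow> generalized_difference_set (cyclic_product t n) M
           (\<Prod>l\<in>{1..t}. n l) (card M) k lam1 lam2 D"
    unfolding order_cyclic_product[OF n, symmetric]
    using generalized_difference_set_iff_prescribed_count[OF group_cyclic_product _ M \<open>k > 1\<close>] D
    by (simp add: carrier finite_index_box)
  finally show ?thesis ..
qed

section \<open>Zero-one vectors as point representations\<close>

lemma P_poly_eq_0_iff: "P_poly i A = (0::'a::idom) \<longleftrightarrow> A i = 0 \<or> A i = 1"
  by (auto simp: P_poly_def power2_eq_square)

text \<open>The equations force values 0 and 1, so \<open>\<alpha>\<close> is the indicator of the
  set where it is 1. Extensionality gives agreement outside the box.\<close>

lemma point_representation_surj:
  assumes "\<alpha> \<in> index_box t n \<rightarrow>\<^sub>E UNIV" "\<forall>i\<in>index_box t n. P_poly i \<alpha> = 0"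
  shows "\<alpha> = point_representation t n {i \<in> index_box t n. \<alpha> i = 1}"
proof (rule ext)
  fix i
  show "\<alpha> i = point_representation t n {i \<in> index_box t n. \<alpha> i = 1} i"
    using assms by (cases "i \<in> index_box t n")
      (auto simp: point_representation_def residue_tuple_index_box P_poly_eq_0_iff)
qed

theorem theorem4p1:
  fixes t :: nat and n :: "nat \<Rightarrow> nat" and k lam1 lam2 :: nat
    and M :: "(nat \<Rightarrow> int) set" and \<alpha> :: "(nat \<Rightarrow> int) \<Rightarrow> complex"
  assumes "\<forall>l\<in>{1..t}. n l > 0"
    and "k > 1"
    and "M \<subseteq> carrier (cyclic_product t n)" and "M \<noteq> {}"
    and "\<alpha> \<in> index_box t n \<rightarrow>\<^sub>E UNIV"
  shows "(\<exists>D. generalized_difference_set (cyclic_product t n) M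
                (\<Prod>l\<in>{1..t}. n l) (card M) k lam1 lam2 D \<and>
              \<alpha> = point_representation t n D) \<longleftrightarrow>
         (\<forall>i\<in>index_box t n. P_poly i \<alpha> = 0) \<and>
         (\<forall>\<xi>\<in>unity_tuples t n. Psi_star t n M k lam1 lam2 \<xi> \<alpha> = 0)"
proof
  assume "\<exists>D. generalized_difference_set (cyclic_product t n) M
                (\<Prod>l\<in>{1..t}. n l) (card M) k lam1 lam2 D \<and> \<alpha> = point_representation t n D"
  then obtain D where D: "generalized_difference_set (cyclic_product t n) M
                (\<Prod>l\<in>{1..t}. n l) (card M) k lam1 lam2 D" and \<alpha>: "\<alpha> = point_representation t n D"
    by blast
  have "D \<subseteq> index_box t n"
    using D carrier_cyclic_product[OF assms(1)] by (simp add: generalized_difference_set_def)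
  then show "(\<forall>i\<in>index_box t n. P_poly i \<alpha> = 0) \<and>
         (\<forall>\<xi>\<in>unity_tuples t n. Psi_star t n M k lam1 lam2 \<xi> \<alpha> = 0)"
    using D generalized_difference_set_iff_Psi_star[OF assms(1-4)]
    by (simp add: \<alpha> P_poly_eq_0_iff point_representation_def)
next
  assume R: "(\<forall>i\<in>index_box t n. P_poly i \<alpha> = 0) \<and>
         (\<forall>\<xi>\<in>unity_tuples t n. Psi_star t n M k lam1 lam2 \<xi> \<alpha> = 0)"
  \<comment> \<open>The only candidate within the box, since \<open>\<alpha>\<close> must be its
    indicator there.\<close>
  define D where "D = {i \<in> index_box t n. \<alpha> i = 1}"
  have \<alpha>: "\<alpha> = point_representation t n D"
    using point_representation_surj[OF assms(5)] R by (simp add: D_def)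
  have "D \<subseteq> index_box t n"
    by (auto simp: D_def)
  then have "generalized_difference_set (cyclic_product t n) M
                (\<Prod>l\<in>{1..t}. n l) (card M) k lam1 lam2 D"
    using R generalized_difference_set_iff_Psi_star[OF assms(1-4)] by (simp add: \<alpha>[symmetric])
  with \<alpha> show "\<exists>D. generalized_difference_set (cyclic_product t n) M
                (\<Prod>l\<in>{1..t}. n l) (card M) k lam1 lam2 D \<and> \<alpha> = point_representation t n D"
    by blast
qed

end
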